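(* Let $\{\underline{\mathbf{w}}_i\}\in\mathcal{W}$, put $\mathbf{S}=\sum_{j=1}^{K}\omega_j a_j\mathbf{h}_j\mathbf{h}_j^{\mathsf{H}}$, and let $\eta>0$ satisfy $\eta\ge\lambda_{\max}(\mathbf{S})$. Define $$\begin{aligned}\ell'(\{\mathbf{w}_i\},\{\underline{\mathbf{w}}_i\})=&-\sum_{k=1}^{K}\Bigl(\eta\mathbf{w}_k^{\mathsf{H}}\mathbf{w}_k+2\mathrm{Re}\bigl(\underline{\mathbf{w}}_k^{\mathsf{H}}(\mathbf{S}-\eta\mathbf{I})\mathbf{w}_k\bigr)+\underline{\mathbf{w}}_k^{\mathsf{H}}(\eta\mathbf{I}-\mathbf{S})\underline{\mathbf{w}}_k\Bigr)\\&+\sum_{k=1}^{K}2\omega_k\mathrm{Re}(b_k\mathbf{h}_k^{\mathsf{H}}\mathbf{w}_k)+\sum_{k=1}^{K}\omega_k\bigl(\underline{\mathsf{R}}_k-\underline{\mathsf{SINR}}_k-a_k\sigma_k^2\bigr).\end{aligned}$$ Then $\ell'(\cdot,\{\underline{\mathbf{w}}_i\})$ is a surrogate function of the weighted sum-rate $f$ at $\{\underline{\mathbf{w}}_i\}$: $\ell'(\{\mathbf{w}_i\},\{\underline{\mathbf{w}}_i\})\le f(\{\mathbf{w}_i\})$ for all $\{\mathbf{w}_i\}\in\mathcal{W}$, with equality at $\{\mathbf{w}_i\}=\{\underline{\mathbf{w}}_i\}$. Moreover, maximizing $\ell'(\cdot,\{\underline{\mathbf{w}}_i\})$ over $\mathcal{W}$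 is equivalent to minimizing $\sum_{k=1}^{K}\eta\|\mathbf{w}_k-\mathbf{q}_k\|^2$ over $\mathcal{W}$, where $$\mathbf{q}_k=\eta^{-1}\Bigl(\omega_k b_k^{*}\mathbf{h}_k-(\mathbf{S}-\eta\mathbf{I})\underline{\mathbf{w}}_k\Bigr),$$ and the solution is $$\mathbf{w}_k=\mathbf{q}_k\min\Bigl\{\sqrt{P/\textstyle\sum_{i=1}^{K}\|\mathbf{q}_i\|^2},\,1\Bigr\},\qquad k=1,\dots,K$$ (read as $\mathbf{w}_k=\mathbf{0}$ for all $k$ when all $\mathbf{q}_i=\mathbf{0}$).
   Context: Setting: $K$ users; channels $\mathbf{h}_k\in\mathbb{C}^M$, beamformers $\mathbf{w}_k\in\mathbb{C}^M$, noise variances $\sigma_k^2>0$, weights $\omega_k>0$, power budget $P>0$. $\mathsf{SINR}_k=\dfrac{|\mathbf{h}_k^{\mathsf{H}}\mathbf{w}_k|^2}{\sum_{j\ne k}|\mathbf{h}_k^{\mathsf{H}}\mathbf{w}_j|^2+\sigma_k^2}$, $\mathsf{R}_k=\log(1+\mathsf{SINR}_k)$ (natural logarithm), $f(\{\mathbf{w}_i\})=\sum_{k=1}^{K}\omega_k\mathsf{R}_k$, $\mathcal{W}=\{\{\mathbf{w}_i\}:\sum_{k=1}^{K}\|\mathbf{w}_k\|^2\le P\}$. Underlined $\underline{\mathsf{SINR}}_k,\underline{\mathsf{R}}_k$ are evaluated at $\{\underline{\mathbf{w}}_i\}$. $a_k=\dfrac{\underline{\mathsf{SINR}}_k}{\sum_{j=1}^{K}|\mathbf{h}_k^{\mathsf{H}}\underline{\mathbf{w}}_j|^2+\sigma_k^2}$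 and $b_k=\dfrac{(\mathbf{h}_k^{\mathsf{H}}\underline{\mathbf{w}}_k)^*}{\sum_{j\ne k}|\mathbf{h}_k^{\mathsf{H}}\underline{\mathbf{w}}_j|^2+\sigma_k^2}$ (which equals $\underline{\mathsf{SINR}}_k/(\mathbf{h}_k^{\mathsf{H}}\underline{\mathbf{w}}_k)$ when $\mathbf{h}_k^{\mathsf{H}}\underline{\mathbf{w}}_k\ne0$). $(\cdot)^*$ on scalars is complex conjugation; $\lambda_{\max}$ is the largest eigenvalue. *)

theory Defs
  imports "HOL-Analysis.Analysis"
begin

text \<open>
  The \<open>K\<close> users are indexed by a finite type \<open>'k\<close> and the \<open>M\<close> antennas by a finite type \<open>'m\<close>;
  a family of beamformers is a function \<open>w :: 'k \<Rightarrow> complex ^ 'm\<close>. The scalar \<open>cdot x y\<close> is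
  \<open>x\<^sup>H y\<close>, conjugate-linear in the first argument (the library inner product on
  \<open>complex ^ 'm\<close> is only its real part).
\<close>

definition cdot :: "complex ^ 'm \<Rightarrow> complex ^ 'm \<Rightarrow> complex" where
  "cdot x y = (\<Sum>i\<in>UNIV. cnj (x $ i) * y $ i)"

definition couter :: "complex ^ 'm \<Rightarrow> complex ^ 'm ^ 'm" where
  "couter x = (\<chi> i j. x $ i * cnj (x $ j))"

definition eigenvalue :: "complex ^ 'm ^ 'm \<Rightarrow> complex \<Rightarrow> bool" where
  "eigenvalue A c \<longleftrightarrow> (\<exists>v. v \<noteq> 0 \<and> A *v v = c *s v)"

text \<open>Meant for Hermitian matrices, all of whose eigenvalues are real.\<close>

definition lambda_max :: "complex ^ 'm ^ 'm \<Rightarrow> real" where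
  "lambda_max A = Max {r. eigenvalue A (complex_of_real r)}"

definition interference ::
    "('k::finite \<Rightarrow> complex ^ 'm) \<Rightarrow> ('k \<Rightarrow> real) \<Rightarrow> ('k \<Rightarrow> complex ^ 'm) \<Rightarrow> 'k \<Rightarrow> real" where
  "interference h \<sigma> w k = (\<Sum>j\<in>UNIV - {k}. (cmod (cdot (h k) (w j)))\<^sup>2) + (\<sigma> k)\<^sup>2"

definition SINR ::
    "('k::finite \<Rightarrow> complex ^ 'm) \<Rightarrow> ('k \<Rightarrow> real) \<Rightarrow> ('k \<Rightarrow> complex ^ 'm) \<Rightarrow> 'k \<Rightarrow> real" where
  "SINR h \<sigma> w k = (cmod (cdot (h k) (w k)))\<^sup>2 / interference h \<sigma> w k"

definition rate ::
    "('k::finite \<Rightarrow> complex ^ 'm) \<Rightarrow> ('k \<Rightarrow> real) \<Rightarrow> ('k \<Rightarrow> complex ^ 'm) \<Rightarrow> 'k \<Rightarrow> real" where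
  "rate h \<sigma> w k = ln (1 + SINR h \<sigma> w k)"

definition weighted_sum_rate ::
    "('k::finite \<Rightarrow> complex ^ 'm) \<Rightarrow> ('k \<Rightarrow> real) \<Rightarrow> ('k \<Rightarrow> real) \<Rightarrow> ('k \<Rightarrow> complex ^ 'm) \<Rightarrow> real" where
  "weighted_sum_rate h \<sigma> \<omega> w = (\<Sum>k\<in>UNIV. \<omega> k * rate h \<sigma> w k)"

definition feasible :: "real \<Rightarrow> ('k::finite \<Rightarrow> complex ^ 'm) set" where
  "feasible P = {w. (\<Sum>k\<in>UNIV. (norm (w k))\<^sup>2) \<le> P}"

definition coef_a ::
    "('k::finite \<Rightarrow> complex ^ 'm) \<Rightarrow> ('k \<Rightarrow> real) \<Rightarrow> ('k \<Rightarrow> complex ^ 'm) \<Rightarrow> 'k \<Rightarrow> real" where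
  "coef_a h \<sigma> w0 k =
     SINR h \<sigma> w0 k / ((\<Sum>j\<in>UNIV. (cmod (cdot (h k) (w0 j)))\<^sup>2) + (\<sigma> k)\<^sup>2)"

definition coef_b ::
    "('k::finite \<Rightarrow> complex ^ 'm) \<Rightarrow> ('k \<Rightarrow> real) \<Rightarrow> ('k \<Rightarrow> complex ^ 'm) \<Rightarrow> 'k \<Rightarrow> complex" where
  "coef_b h \<sigma> w0 k = cnj (cdot (h k) (w0 k)) / complex_of_real (interference h \<sigma> w0 k)"

definition mat_S ::
    "('k::finite \<Rightarrow> complex ^ 'm) \<Rightarrow> ('k \<Rightarrow> real) \<Rightarrow> ('k \<Rightarrow> real) \<Rightarrow> ('k \<Rightarrow> complex ^ 'm)
      \<Rightarrow> complex ^ 'm ^ 'm" where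
  "mat_S h \<sigma> \<omega> w0 = (\<Sum>j\<in>UNIV. (\<omega> j * coef_a h \<sigma> w0 j) *\<^sub>R couter (h j))"

text \<open>
  The quadratic forms \<open>w\<^sup>H w\<close> and \<open>w0\<^sup>H (\<eta> I - S) w0\<close> are real because the matrices involved are
  Hermitian; \<open>Re\<close> only converts them from type \<open>complex\<close> to type \<open>real\<close>.
\<close>

definition surrogate ::
    "('k::finite \<Rightarrow> complex ^ 'm) \<Rightarrow> ('k \<Rightarrow> real) \<Rightarrow> ('k \<Rightarrow> real) \<Rightarrow> real
      \<Rightarrow> ('k \<Rightarrow> complex ^ 'm) \<Rightarrow> ('k \<Rightarrow> complex ^ 'm) \<Rightarrow> real" where
  "surrogate h \<sigma> \<omega> \<eta> w w0 =
     - (\<Sum>k\<in>UNIV. \<eta> * Re (cdot (w k) (w k))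
          + 2 * Re (cdot (w0 k) ((mat_S h \<sigma> \<omega> w0 - \<eta> *\<^sub>R mat 1) *v w k))
          + Re (cdot (w0 k) ((\<eta> *\<^sub>R mat 1 - mat_S h \<sigma> \<omega> w0) *v w0 k)))
     + (\<Sum>k\<in>UNIV. 2 * \<omega> k * Re (coef_b h \<sigma> w0 k * cdot (h k) (w k)))
     + (\<Sum>k\<in>UNIV. \<omega> k * (rate h \<sigma> w0 k - SINR h \<sigma> w0 k - coef_a h \<sigma> w0 k * (\<sigma> k)\<^sup>2))"

definition vec_q ::
    "('k::finite \<Rightarrow> complex ^ 'm) \<Rightarrow> ('k \<Rightarrow> real) \<Rightarrow> ('k \<Rightarrow> real) \<Rightarrow> real
      \<Rightarrow> ('k \<Rightarrow> complex ^ 'm) \<Rightarrow> 'k \<Rightarrow> complex ^ 'm" where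
  "vec_q h \<sigma> \<omega> \<eta> w0 k =
     inverse \<eta> *\<^sub>R ((complex_of_real (\<omega> k) * cnj (coef_b h \<sigma> w0 k)) *s h k
       - (mat_S h \<sigma> \<omega> w0 - \<eta> *\<^sub>R mat 1) *v w0 k)"

text \<open>
  If all \<open>q i\<close> vanish, the quotient below is \<open>P / 0 = 0\<close> and the result is the zero family.
\<close>

definition scaled_to_budget ::
    "real \<Rightarrow> ('k::finite \<Rightarrow> complex ^ 'm) \<Rightarrow> 'k \<Rightarrow> complex ^ 'm" where
  "scaled_to_budget P q k = min (sqrt (P / (\<Sum>i\<in>UNIV. (norm (q i))\<^sup>2))) 1 *\<^sub>R q k"

end

theory Submission
  imports Defs
begin

text \<open>
  Put \<open>D = interference\<close> and \<open>T = D + (cmod y)\<^sup>2\<close> with \<open>y = h\<^sub>k\<^sup>H w\<^sub>k\<close>. Then \<open>1 + SINR = T / D\<close>, and the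
  bound \<open>ln z \<le> z - 1\<close>, applied to the quotient of the values of \<open>T / D\<close> at the two points, followed
  by AM-GM, minorizes each rate by a concave quadratic that is tight at \<open>w0\<close>. Its quadratic part
  sums to \<open>- \<Sum>\<^sub>k w\<^sub>k\<^sup>H S w\<^sub>k\<close>, which \<open>\<eta> I - S \<ge> 0\<close> minorizes further at \<open>w0\<close>. The result has the
  Hessian of \<open>- \<eta> \<Sum>\<^sub>k \<parallel>w\<^sub>k\<parallel>\<^sup>2\<close>, so completing the square reduces its maximization to projecting \<open>q\<close>
  onto a ball.
\<close>

section \<open>Complex vectors as a real inner product space\<close>

lemma Re_cdot: "Re (cdot x y) = x \<bullet> y"
  by (simp add: cdot_def inner_vec_def inner_complex_def)

text \<open>Turns the linear term with \<open>coef_b\<close> into a real inner product against the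
  vector that appears in \<open>vec_q\<close>.\<close>

lemma Re_mult_cdot: "Re (c * cdot x y) = (cnj c *s x) \<bullet> y"
  by (simp add: cdot_def inner_vec_def inner_complex_def sum_distrib_left Re_sum algebra_simps)

lemma of_real_mult_vec: "(complex_of_real r * c) *s v = r *\<^sub>R (c *s v)"
  by (simp add: vec_eq_iff scaleR_conv_of_real[where 'a = complex])

lemma scaleR_matrix_vector_mult: "(r *\<^sub>R A) *v x = r *\<^sub>R (A *v x)" for A :: "complex ^ 'n ^ 'm"
  by (simp add: vec_eq_iff matrix_vector_mult_def scaleR_sum_right)

lemma linear_matrix_vector_mult: "linear ((*v) A)" for A :: "complex ^ 'n ^ 'm"
  by (rule linearI)
    (simp_all add: vec_eq_iff matrix_vector_mult_def scaleR_sum_right algebra_simps sum.distrib)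

lemma couter_mult_vec: "couter x *v y = cdot x y *s x"
  by (simp add: vec_eq_iff matrix_vector_mult_def couter_def cdot_def sum_distrib_left
      sum_distrib_right mult_ac)

lemma sum_matrix_vector_mult: "(\<Sum>i\<in>I. A i) *v x = (\<Sum>i\<in>I. A i *v x)"
  for A :: "'i \<Rightarrow> complex ^ 'n ^ 'm"
  by (induction I rule: infinite_finite_induct) (simp_all add: matrix_vector_mult_add_rdistrib)

lemma cnj_cdot: "cnj (cdot x y) = cdot y x"
  by (simp add: cdot_def mult.commute)

lemma inner_couter_mult_vec: "x \<bullet> (couter z *v y) = Re (cdot x z * cdot z y)"
  by (subst inner_commute, subst couter_mult_vec)
    (metis Re_mult_cdot cnj_cdot complex_cnj_cnj complex_cnj_mult cnj.simps(1) mult.commute)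

lemma inner_mat_S_mult_vec:
  "x \<bullet> (mat_S h \<sigma> \<omega> w0 *v y)
    = (\<Sum>j\<in>UNIV. \<omega> j * coef_a h \<sigma> w0 j * Re (cdot x (h j) * cdot (h j) y))"
  by (simp add: mat_S_def sum_matrix_vector_mult scaleR_matrix_vector_mult inner_sum_right
      inner_couter_mult_vec)

text \<open>Exchanging \<open>x\<close> and \<open>y\<close> conjugates each rank-one term, and the
  weights are real, so the real parts agree.\<close>

lemma mat_S_selfadjoint: "x \<bullet> (mat_S h \<sigma> \<omega> w0 *v y) = (mat_S h \<sigma> \<omega> w0 *v x) \<bullet> y"
proof -
  have "Re (cdot x z * cdot z y) = Re (cdot y z * cdot z x)" for z
  proof -
    have "cnj (cdot x z * cdot z y) = cdot y z * cdot z x"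
      by (simp add: cnj_cdot mult.commute)
    then show ?thesis by (metis cnj.sel(1))
  qed
  then show ?thesis
    by (simp only: inner_commute[of "_ *v x" y] inner_mat_S_mult_vec)
qed

lemma inner_mat_S_mult_vec_self:
  "x \<bullet> (mat_S h \<sigma> \<omega> w0 *v x) = (\<Sum>j\<in>UNIV. \<omega> j * coef_a h \<sigma> w0 j * (cmod (cdot (h j) x))\<^sup>2)"
proof -
  have "Re (cdot x z * cdot z x) = (cmod (cdot z x))\<^sup>2" for z
    by (metis Re_complex_of_real cnj_cdot complex_norm_square mult.commute)
  then show ?thesis
    by (simp add: inner_mat_S_mult_vec)
qed

section \<open>Largest eigenvalue of a self-adjoint map\<close>

text \<open>Eigenvectors for distinct eigenvalues are orthogonal, and an orthogonal set is finite in
  finite dimension. Finiteness is what gives the \<open>Max\<close> in \<open>lambda_max\<close> its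
  meaning.\<close>

lemma selfadjoint_finite_eigenvalues:
  fixes T :: "'a::euclidean_space \<Rightarrow> 'a"
  assumes sym: "\<And>x y. x \<bullet> T y = T x \<bullet> y"
  shows "finite {r. \<exists>v. v \<noteq> 0 \<and> T v = r *\<^sub>R v}" (is "finite ?E")
proof -
  define v where "v r = (SOME v. v \<noteq> 0 \<and> T v = r *\<^sub>R v)" for r
  have v: "v r \<noteq> 0" "T (v r) = r *\<^sub>R v r" if "r \<in> ?E" for r
    using someI_ex[of "\<lambda>v. v \<noteq> 0 \<and> T v = r *\<^sub>R v"] that unfolding v_def by auto
  have orth: "v r \<bullet> v s = 0" if "r \<in> ?E" "s \<in> ?E" "r \<noteq> s" for r s
    using sym[of "v r" "v s"] v(2)[OF that(1)] v(2)[OF that(2)] that(3) by simp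
  have "inj_on v ?E"
  proof (rule inj_onI)
    fix r s assume rs: "r \<in> ?E" "s \<in> ?E" "v r = v s"
    then have "v r \<bullet> v s \<noteq> 0" using v(1)[OF rs(1)] by simp
    then show "r = s" using orth[OF rs(1,2)] by blast
  qed
  moreover have "finite (v ` ?E)"
  proof (rule pairwise_orthogonal_imp_finite)
    show "pairwise orthogonal (v ` ?E)"
      unfolding pairwise_def orthogonal_def using orth by blast
  qed
  ultimately show ?thesis
    by (rule finite_imageD[rotated])
qed

text \<open>Otherwise a small step from \<open>v\<close> along \<open>- T v\<close> would make the
  form negative: the first-order term decreases it, while the form starts at zero.\<close>

lemma psd_form_null_vector:
  fixes T :: "'a::real_inner \<Rightarrow> 'a"
  assumes lin: "linear T" and sym: "\<And>x y. x \<bullet> T y = T x \<bullet> y"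
    and psd: "\<And>x. x \<bullet> T x \<ge> 0" and null: "v \<bullet> T v = 0"
  shows "T v = 0"
proof (rule ccontr)
  assume "T v \<noteq> 0"
  then have pos: "T v \<bullet> T v > 0" by simp
  define p where "p = T v \<bullet> T v"
  define g where "g = T v \<bullet> T (T v)"
  \<comment> \<open>Small enough that \<open>t * g \<le> p\<close>, hence
    \<open>t * g - 2 * p < 0\<close>; adding \<open>p\<close> to the denominator keeps it positive
    even when \<open>g = 0\<close>.\<close>
  define t where "t = p / (g + p)"
  have g: "g \<ge> 0" using psd g_def by blast
  have p: "p > 0" using pos p_def by simp
  have "(v - t *\<^sub>R T v) \<bullet> T (v - t *\<^sub>R T v) = t * (t * g - 2 * p)"
    using null sym[of v "T v"] unfolding g_def p_def
    by (simp add: linear_diff[OF lin] linear_scale[OF lin] inner_diff_left inner_diff_right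
        algebra_simps inner_commute)
  then have "0 \<le> t * (t * g - 2 * p)" using psd by metis
  moreover have "t > 0" unfolding t_def using g p by simp
  moreover have "t * g \<le> p" unfolding t_def using g p by (simp add: field_simps)
  ultimately show False using p by (auto simp: zero_le_mult_iff)
qed

text \<open>The Rayleigh quotient attains its maximum \<open>r\<close> on the compact unit sphere.
  The maximizer is a null vector of the positive semidefinite form of \<open>r I - T\<close>, hence
  an eigenvector.\<close>

lemma selfadjoint_max_eigenvalue:
  fixes T :: "'a::euclidean_space \<Rightarrow> 'a"
  assumes lin: "linear T" and sym: "\<And>x y. x \<bullet> T y = T x \<bullet> y"
  obtains r v where "v \<noteq> 0" "T v = r *\<^sub>R v" "\<And>x. x \<bullet> T x \<le> r * (x \<bullet> x)"
proof -
  have "sphere (0::'a) 1 \<noteq> {}" by simp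
  moreover have "continuous_on (sphere 0 1) (\<lambda>x. x \<bullet> T x)"
    by (intro continuous_intros linear_continuous_on_compose[OF _ lin])
  ultimately obtain v where v: "norm v = 1" and max: "\<And>x. norm x = 1 \<Longrightarrow> x \<bullet> T x \<le> v \<bullet> T v"
    using continuous_attains_sup[OF compact_sphere, of 0 1 "\<lambda>x. x \<bullet> T x"] by auto
  define r where "r = v \<bullet> T v"
  have bound: "x \<bullet> T x \<le> r * (x \<bullet> x)" for x
  proof (cases "x = 0")
    case False
    let ?u = "x /\<^sub>R norm x"
    have "x \<bullet> T x = (norm x)\<^sup>2 * (?u \<bullet> T ?u)"
      using False by (simp add: linear_scale[OF lin] power2_eq_square field_simps)
    also have "\<dots> \<le> (norm x)\<^sup>2 * r"
      unfolding r_def using False by (intro mult_left_mono max) simp_all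
    finally show ?thesis
      by (simp add: power2_norm_eq_inner mult.commute)
  qed simp
  have "r *\<^sub>R v - T v = 0"
  proof (rule psd_form_null_vector[where T = "\<lambda>x. r *\<^sub>R x - T x"])
    show "linear (\<lambda>x. r *\<^sub>R x - T x)"
      by (rule linearI) (simp_all add: linear_add[OF lin] linear_scale[OF lin] algebra_simps)
    show "v \<bullet> (r *\<^sub>R v - T v) = 0"
      using v by (simp add: inner_diff_right r_def power2_norm_eq_inner[symmetric])
  qed (use bound sym in \<open>simp_all add: inner_diff_right inner_diff_left\<close>)
  then show thesis
    using v bound by (intro that[of v r]) auto
qed

lemma inner_mult_vec_le_lambda_max:
  fixes A :: "complex ^ 'm ^ 'm"
  assumes sym: "\<And>x y. x \<bullet> (A *v y) = (A *v x) \<bullet> y"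
  shows "x \<bullet> (A *v x) \<le> lambda_max A * (x \<bullet> x)"
proof -
  \<comment> \<open>For real scalars the complex eigenvalue equation is that of the underlying
    real-linear map, so the real spectral lemmas apply.\<close>
  have E: "{r. eigenvalue A (complex_of_real r)} = {r. \<exists>v. v \<noteq> 0 \<and> A *v v = r *\<^sub>R v}"
    by (simp add: eigenvalue_def of_real_mult_vec[where c = 1, simplified])
  obtain r v where "v \<noteq> 0" "A *v v = r *\<^sub>R v" and r: "\<And>x. x \<bullet> (A *v x) \<le> r * (x \<bullet> x)"
    using selfadjoint_max_eigenvalue[OF linear_matrix_vector_mult sym] by blast
  then have "r \<le> lambda_max A"
    unfolding lambda_max_def E
    by (intro Max_ge selfadjoint_finite_eigenvalues[OF sym]) auto
  then show ?thesis
    using r[of x] by (meson inner_ge_zero mult_right_mono order_trans)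
qed

section \<open>Concave quadratic minorant of the rates\<close>

lemma ln_one_plus_ratio_minorant:
  fixes y y0 :: complex and V V0 :: real
  assumes V: "V > 0" and V0: "V0 > 0"
  defines "x0 \<equiv> (cmod y0)\<^sup>2 / V0"
  shows "ln (1 + x0) - x0 + 2 * Re (cnj y0 / complex_of_real V0 * y)
      - x0 / ((cmod y0)\<^sup>2 + V0) * ((cmod y)\<^sup>2 + V) \<le> ln (1 + (cmod y)\<^sup>2 / V)"
proof -
  define T where "T = (cmod y)\<^sup>2 + V"
  define T0 where "T0 = (cmod y0)\<^sup>2 + V0"
  have T: "T > 0" "T0 > 0" unfolding T_def T0_def using V V0 by (simp_all add: add_nonneg_pos)
  have ratio: "1 + x0 = T0 / V0" "1 + (cmod y)\<^sup>2 / V = T / V"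
    unfolding x0_def T_def T0_def using V V0 by (simp_all add: field_simps)
  have "ln (T0 / V0) - ln (T / V) = ln (T0 / V0 / (T / V))"
    using V V0 T by (simp add: ln_div ln_mult)
  also have "\<dots> \<le> T0 / V0 / (T / V) - 1"
    using V V0 T by (intro ln_le_minus_one) simp
  finally have ln: "ln (1 + x0) - ln (1 + (cmod y)\<^sup>2 / V) \<le> T0 * V / (V0 * T) - 1"
    unfolding ratio by simp
  have "Re (cnj y0 / complex_of_real V0 * y) = Re (cnj y0 * y) / V0"
    by (metis Re_divide_of_real times_divide_eq_left)
  also have "\<dots> \<le> cmod y0 * cmod y / V0"
    using complex_Re_le_cmod[of "cnj y0 * y"] V0
    by (intro divide_right_mono) (simp_all add: norm_mult)
  finally have cross: "2 * Re (cnj y0 / complex_of_real V0 * y) \<le> 2 * (cmod y0 * cmod y / V0)"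
    by linarith
  \<comment> \<open>AM-GM as a perfect square: \<open>cmod y0 * cmod y / V0\<close> is the geometric
    mean of the two positive terms in the expansion.\<close>
  have "0 \<le> (T0 * cmod y - T * cmod y0)\<^sup>2 / (V0 * T * T0)"
    using V0 T by simp
  also have "\<dots> = T0 * (cmod y)\<^sup>2 / (V0 * T) + (cmod y0)\<^sup>2 * T / (V0 * T0) - 2 * (cmod y0 * cmod y / V0)"
    using V0 T by (simp add: field_simps power2_eq_square)
  \<comment> \<open>Exposes \<open>T0 * V / (V0 * T)\<close>, the term of the logarithmic bound, so
    that the estimates combine linearly.\<close>
  also have "T0 * (cmod y)\<^sup>2 / (V0 * T) = T0 / V0 - T0 * V / (V0 * T)"
  proof -
    have *: "(cmod y)\<^sup>2 = T - V" unfolding T_def by simp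
    show ?thesis unfolding * using V0 T by (simp add: field_simps)
  qed
  also have "(cmod y0)\<^sup>2 * T / (V0 * T0) = x0 / T0 * T"
    unfolding x0_def by simp
  finally show ?thesis
    using ln cross ratio(1) unfolding T_def T0_def by linarith
qed

lemma interference_pos: "(\<sigma> k)\<^sup>2 > 0 \<Longrightarrow> interference h \<sigma> w k > 0"
  unfolding interference_def by (simp add: add_nonneg_pos sum_nonneg)

lemma sum_cmod_cdot_eq_interference:
  "(\<Sum>j\<in>UNIV. (cmod (cdot (h k) (w j)))\<^sup>2) + (\<sigma> k)\<^sup>2
    = (cmod (cdot (h k) (w k)))\<^sup>2 + interference h \<sigma> w k"
  unfolding interference_def by (subst sum.remove[of UNIV k]) simp_all

text \<open>The per-user bound before \<open>S\<close> is majorized by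
  \<open>\<eta> I\<close>.\<close>

definition rate_minorant ::
    "('k::finite \<Rightarrow> complex ^ 'm) \<Rightarrow> ('k \<Rightarrow> real) \<Rightarrow> ('k \<Rightarrow> complex ^ 'm) \<Rightarrow> ('k \<Rightarrow> complex ^ 'm)
      \<Rightarrow> 'k \<Rightarrow> real" where
  "rate_minorant h \<sigma> w w0 k = rate h \<sigma> w0 k - SINR h \<sigma> w0 k
     + 2 * Re (coef_b h \<sigma> w0 k * cdot (h k) (w k))
     - coef_a h \<sigma> w0 k * ((\<Sum>j\<in>UNIV. (cmod (cdot (h k) (w j)))\<^sup>2) + (\<sigma> k)\<^sup>2)"

lemma rate_minorant_le:
  assumes "(\<sigma> k)\<^sup>2 > 0"
  shows "rate_minorant h \<sigma> w w0 k \<le> rate h \<sigma> w k"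
  using ln_one_plus_ratio_minorant[OF interference_pos[of \<sigma> k h w, OF assms]
      interference_pos[of \<sigma> k h w0, OF assms]]
  unfolding rate_minorant_def coef_a_def coef_b_def sum_cmod_cdot_eq_interference
  by (simp add: rate_def SINR_def)

text \<open>At \<open>w0\<close> the linear term equals twice the SINR, and \<open>coef_a\<close>
  times its own denominator gives one SINR back, so everything but the rate cancels.\<close>

lemma rate_minorant_self:
  assumes "(\<sigma> k)\<^sup>2 > 0"
  shows "rate_minorant h \<sigma> w0 w0 k = rate h \<sigma> w0 k"
proof -
  let ?y = "cdot (h k) (w0 k)" and ?V = "interference h \<sigma> w0 k"
  have V: "?V > 0" using assms by (rule interference_pos)
  have "cnj ?y / complex_of_real ?V * ?y = complex_of_real ((cmod ?y)\<^sup>2 / ?V)"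
    using complex_norm_square[of ?y] by (simp add: mult.commute)
  then have "Re (coef_b h \<sigma> w0 k * ?y) = SINR h \<sigma> w0 k"
    unfolding coef_b_def SINR_def by (metis Re_complex_of_real)
  moreover have "(cmod ?y)\<^sup>2 + ?V \<noteq> 0"
    using V by (metis add_nonneg_pos less_numeral_extra(3) zero_le_power2)
  ultimately show ?thesis
    unfolding rate_minorant_def coef_a_def sum_cmod_cdot_eq_interference by simp
qed

text \<open>Swapping the sums over receiving users and over beams gathers all quadratic terms into
  the single matrix \<open>S\<close>.\<close>

lemma sum_rate_minorant:
  "(\<Sum>k\<in>UNIV. \<omega> k * rate_minorant h \<sigma> w w0 k)
    = - (\<Sum>k\<in>UNIV. w k \<bullet> (mat_S h \<sigma> \<omega> w0 *v w k))
      + (\<Sum>k\<in>UNIV. 2 * \<omega> k * Re (coef_b h \<sigma> w0 k * cdot (h k) (w k)))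
      + (\<Sum>k\<in>UNIV. \<omega> k * (rate h \<sigma> w0 k - SINR h \<sigma> w0 k - coef_a h \<sigma> w0 k * (\<sigma> k)\<^sup>2))"
proof -
  have "(\<Sum>k\<in>UNIV. w k \<bullet> (mat_S h \<sigma> \<omega> w0 *v w k))
      = (\<Sum>j\<in>UNIV. \<omega> j * (coef_a h \<sigma> w0 j * (\<Sum>k\<in>UNIV. (cmod (cdot (h j) (w k)))\<^sup>2)))"
    unfolding inner_mat_S_mult_vec_self
    by (subst sum.swap) (simp add: sum_distrib_left mult.assoc)
  then show ?thesis
    unfolding rate_minorant_def
    by (simp add: sum.distrib sum_subtractf algebra_simps)
qed

section \<open>Majorizing \<open>S\<close> by \<open>\<eta> I\<close> and completing the
  square\<close>

lemma mult_vec_shift: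
  "(A - \<eta> *\<^sub>R mat 1) *v x = A *v x - \<eta> *\<^sub>R x"
  "(\<eta> *\<^sub>R mat 1 - A) *v x = \<eta> *\<^sub>R x - A *v x"
  for A :: "complex ^ 'm ^ 'm"
  by (simp_all add: matrix_vector_mult_diff_rdistrib scaleR_matrix_vector_mult)

text \<open>Isolates the loss from replacing \<open>S\<close> by \<open>\<eta> I\<close> as the form
  of \<open>\<eta> I - S\<close> at \<open>w - w0\<close>: it vanishes at \<open>w0\<close> and is
  nonnegative once \<open>\<eta>\<close> dominates \<open>S\<close>.\<close>

lemma surrogate_eq_sum_rate_minorant:
  "surrogate h \<sigma> \<omega> \<eta> w w0 = (\<Sum>k\<in>UNIV. \<omega> k * rate_minorant h \<sigma> w w0 k)
     - (\<Sum>k\<in>UNIV. \<eta> * ((w k - w0 k) \<bullet> (w k - w0 k))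
          - (w k - w0 k) \<bullet> (mat_S h \<sigma> \<omega> w0 *v (w k - w0 k)))"
proof -
  let ?S = "mat_S h \<sigma> \<omega> w0"
  have "\<eta> * Re (cdot x x) + 2 * Re (cdot y ((?S - \<eta> *\<^sub>R mat 1) *v x))
      + Re (cdot y ((\<eta> *\<^sub>R mat 1 - ?S) *v y))
    = x \<bullet> (?S *v x) + (\<eta> * ((x - y) \<bullet> (x - y)) - (x - y) \<bullet> (?S *v (x - y)))" for x y
    using mat_S_selfadjoint[of x h \<sigma> \<omega> w0 y]
    unfolding Re_cdot mult_vec_shift
    by (simp add: matrix_vector_mult_diff_distrib inner_diff_left
        inner_diff_right inner_commute algebra_simps)
  then show ?thesis
    unfolding surrogate_def sum_rate_minorant by (simp add: sum.distrib)
qed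

lemma surrogate_complete_square:
  assumes "\<eta> > 0"
  obtains C where
    "\<And>w. surrogate h \<sigma> \<omega> \<eta> w w0 = C - (\<Sum>k\<in>UNIV. \<eta> * (norm (w k - vec_q h \<sigma> \<omega> \<eta> w0 k))\<^sup>2)"
proof -
  let ?S = "mat_S h \<sigma> \<omega> w0" and ?q = "vec_q h \<sigma> \<omega> \<eta> w0"
  let ?N = "\<lambda>k. w0 k \<bullet> ((\<eta> *\<^sub>R mat 1 - ?S) *v w0 k)"
  let ?c = "\<Sum>k\<in>UNIV. \<omega> k * (rate h \<sigma> w0 k - SINR h \<sigma> w0 k - coef_a h \<sigma> w0 k * (\<sigma> k)\<^sup>2)"
  \<comment> \<open>The right-hand side is half the coefficient of the linear part of the surrogate
    in \<open>w k\<close>; this is what makes \<open>?q k\<close> the centre of the square.\<close>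
  have q: "\<eta> *\<^sub>R ?q k = \<omega> k *\<^sub>R (cnj (coef_b h \<sigma> w0 k) *s h k) - (?S *v w0 k - \<eta> *\<^sub>R w0 k)" for k
    using assms by (simp add: vec_q_def mult_vec_shift of_real_mult_vec)
  have "\<eta> * Re (cdot x x) + 2 * Re (cdot (w0 k) ((?S - \<eta> *\<^sub>R mat 1) *v x))
      + Re (cdot (w0 k) ((\<eta> *\<^sub>R mat 1 - ?S) *v w0 k))
      - 2 * \<omega> k * Re (coef_b h \<sigma> w0 k * cdot (h k) x)
    = \<eta> * (norm (x - ?q k))\<^sup>2 - (\<eta> * (norm (?q k))\<^sup>2 - ?N k)" for x k
  proof -
    have "\<eta> * (?q k \<bullet> x) = \<omega> k * ((cnj (coef_b h \<sigma> w0 k) *s h k) \<bullet> x)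
        - ((?S *v w0 k) \<bullet> x - \<eta> * (w0 k \<bullet> x))"
      by (metis (no_types) q inner_diff_left inner_scaleR_left)
    moreover have "\<eta> * (norm (x - ?q k))\<^sup>2
        = \<eta> * (x \<bullet> x) - 2 * (\<eta> * (?q k \<bullet> x)) + \<eta> * (norm (?q k))\<^sup>2"
      by (simp add: power2_norm_eq_inner inner_diff_left inner_diff_right inner_commute
          algebra_simps)
    ultimately show ?thesis
      using mat_S_selfadjoint[of "w0 k" h \<sigma> \<omega> w0 x]
      unfolding Re_cdot Re_mult_cdot mult_vec_shift by (simp add: inner_diff_right algebra_simps)
  qed
  note square = this
  have "surrogate h \<sigma> \<omega> \<eta> w w0
      = (\<Sum>k\<in>UNIV. \<eta> * (norm (?q k))\<^sup>2 - ?N k) + ?c - (\<Sum>k\<in>UNIV. \<eta> * (norm (w k - ?q k))\<^sup>2)" for w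
  proof -
    have "surrogate h \<sigma> \<omega> \<eta> w w0 = ?c - (\<Sum>k\<in>UNIV. \<eta> * Re (cdot (w k) (w k))
        + 2 * Re (cdot (w0 k) ((?S - \<eta> *\<^sub>R mat 1) *v w k))
        + Re (cdot (w0 k) ((\<eta> *\<^sub>R mat 1 - ?S) *v w0 k))
        - 2 * \<omega> k * Re (coef_b h \<sigma> w0 k * cdot (h k) (w k)))"
      unfolding surrogate_def sum_subtractf by linarith
    then show ?thesis
      unfolding square sum_subtractf by linarith
  qed
  then show thesis by (rule that)
qed

section \<open>Projection onto the power ball\<close>

lemma scaled_to_budget_feasible:
  assumes "P > 0"
  shows "scaled_to_budget P q \<in> feasible P"
proof -
  let ?Q = "\<Sum>i\<in>UNIV. (norm (q i))\<^sup>2"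
  let ?c = "min (sqrt (P / ?Q)) 1"
  have Q: "?Q \<ge> 0" by (simp add: sum_nonneg)
  have "0 \<le> ?c" "?c \<le> sqrt (P / ?Q)" using assms Q by auto
  then have "?c\<^sup>2 \<le> P / ?Q"
    using assms Q by (metis divide_nonneg_nonneg less_imp_le power_mono real_sqrt_pow2)
  then have "?c\<^sup>2 * ?Q \<le> P"
    using assms Q by (cases "?Q = 0") (auto simp: field_simps)
  then show ?thesis
    by (simp add: feasible_def scaled_to_budget_def power_mult_distrib sum_distrib_left)
qed

text \<open>Follows from the variational inequality of a projection, that \<open>w - p\<close> and
  \<open>q - p\<close> have nonpositive inner product. Keeping the squared distance to
  \<open>p\<close> yields uniqueness later.\<close>

lemma scaled_to_budget_pythagoras:
  fixes w q :: "'k::finite \<Rightarrow> complex ^ 'm"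
  assumes P: "P > 0" and w: "w \<in> feasible P"
  defines "p \<equiv> scaled_to_budget P q"
  shows "(\<Sum>k\<in>UNIV. (norm (p k - q k))\<^sup>2) + (\<Sum>k\<in>UNIV. (norm (w k - p k))\<^sup>2)
    \<le> (\<Sum>k\<in>UNIV. (norm (w k - q k))\<^sup>2)"
proof -
  let ?Q = "\<Sum>i\<in>UNIV. (norm (q i))\<^sup>2"
  define c where "c = min (sqrt (P / ?Q)) 1"
  have p: "p k = c *\<^sub>R q k" for k unfolding p_def scaled_to_budget_def c_def ..
  have "(\<Sum>k\<in>UNIV. (w k - p k) \<bullet> (q k - p k)) \<le> 0"
  \<comment> \<open>If \<open>?Q = 0\<close>, division by zero gives \<open>c = 0\<close>, but then
    \<open>q\<close> is zero as well and still \<open>p = q\<close>.\<close>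
  proof (cases "c = 1 \<or> ?Q = 0")
    case True
    then have "p k = q k" for k
      by (auto simp: p sum_nonneg_eq_0_iff)
    then show ?thesis by simp
  next
    case False
    then have Q: "?Q > 0"
      by (metis order_le_less sum_nonneg zero_le_power2)
    have c: "c = sqrt (P / ?Q)" using False unfolding c_def min_def by presburger
    have c1: "c < 1" using False unfolding c_def by (meson min.cobounded2 order_le_neq_trans)
    have c0: "c > 0" unfolding c using P Q by simp
    have "(\<Sum>k\<in>UNIV. (norm (p k))\<^sup>2) = c\<^sup>2 * ?Q"
      by (simp add: p power_mult_distrib sum_distrib_left)
    also have "\<dots> = P" unfolding c using P Q by simp
    finally have pP: "(\<Sum>k\<in>UNIV. (norm (p k))\<^sup>2) = P" .
    \<comment> \<open>Here \<open>p\<close> spends exactly the budget and \<open>w\<close> at most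
      that, so these bounds sum to something nonpositive.\<close>
    have "(w k - p k) \<bullet> p k \<le> ((norm (w k))\<^sup>2 - (norm (p k))\<^sup>2) / 2" for k
      using inner_ge_zero[of "w k - p k"]
      by (simp add: power2_norm_eq_inner inner_diff_left inner_diff_right inner_commute)
    then have "(\<Sum>k\<in>UNIV. (w k - p k) \<bullet> p k) \<le> (\<Sum>k\<in>UNIV. ((norm (w k))\<^sup>2 - (norm (p k))\<^sup>2) / 2)"
      by (rule sum_mono)
    also have "\<dots> \<le> 0"
      using w pP by (simp add: feasible_def sum_subtractf flip: sum_divide_distrib)
    finally have le: "(\<Sum>k\<in>UNIV. (w k - p k) \<bullet> p k) \<le> 0" .
    \<comment> \<open>Since \<open>p\<close> shrinks \<open>q\<close> radially, the residual is a
      positive multiple of \<open>p\<close>, and the sign carries over.\<close>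
    have "q k - p k = ((1 - c) / c) *\<^sub>R p k" for k
      using c0 by (simp add: p scaleR_diff_left)
    then have "(\<Sum>k\<in>UNIV. (w k - p k) \<bullet> (q k - p k))
        = (1 - c) / c * (\<Sum>k\<in>UNIV. (w k - p k) \<bullet> p k)"
      by (simp add: sum_distrib_left)
    then show ?thesis
      using le c0 c1 by (simp add: mult_nonneg_nonpos divide_nonpos_pos)
  qed
  moreover have "(norm (w k - q k))\<^sup>2 = (norm (p k - q k))\<^sup>2 + (norm (w k - p k))\<^sup>2
      - 2 * ((w k - p k) \<bullet> (q k - p k))" for k
    by (simp add: power2_norm_eq_inner inner_diff_left inner_diff_right inner_commute)
  ultimately show ?thesis
    by (simp add: sum.distrib sum_subtractf flip: sum_distrib_left)
qed

text \<open>The Pythagorean gap is nonnegative, giving optimality, and must vanish at any minimizer,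
  giving uniqueness.\<close>

lemma is_arg_min_scaled_to_budget_iff:
  assumes P: "P > 0" and \<eta>: "\<eta> > 0"
  shows "is_arg_min (\<lambda>w. \<Sum>k\<in>UNIV. \<eta> * (norm (w k - q k))\<^sup>2) (\<lambda>w. w \<in> feasible P) w
    \<longleftrightarrow> w = scaled_to_budget P q" (is "is_arg_min ?F _ _ \<longleftrightarrow> w = ?p")
proof -
  have pyth: "?F ?p + (\<Sum>k\<in>UNIV. \<eta> * (norm (u k - ?p k))\<^sup>2) \<le> ?F u" if "u \<in> feasible P" for u
    using mult_left_mono[OF scaled_to_budget_pythagoras[OF P that, of q], of \<eta>] \<eta>
    by (simp add: distrib_left sum_distrib_left)
  have gap: "(\<Sum>k\<in>UNIV. \<eta> * (norm (u k - ?p k))\<^sup>2) \<ge> 0" for u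
    using \<eta> by (simp add: sum_nonneg)
  show ?thesis
  proof
    assume w: "is_arg_min ?F (\<lambda>w. w \<in> feasible P) w"
    then have "w \<in> feasible P" "?F w \<le> ?F ?p"
      using scaled_to_budget_feasible[OF P, of q] by (auto simp: is_arg_min_linorder)
    then have "(\<Sum>k\<in>UNIV. \<eta> * (norm (w k - ?p k))\<^sup>2) = 0"
      using pyth[of w] gap[of w] by linarith
    then show "w = ?p"
      using \<eta> by (subst (asm) sum_nonneg_eq_0_iff) auto
  next
    assume "w = ?p"
    then show "is_arg_min ?F (\<lambda>w. w \<in> feasible P) w"
      using pyth gap scaled_to_budget_feasible[OF P, of q]
      by (auto simp: is_arg_min_linorder intro: order_trans[OF _ pyth])
  qed
qed

theorem mainTheorem8:
  fixes h w0 :: "'k::finite \<Rightarrow> complex ^ 'm"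
    and \<sigma> \<omega> :: "'k \<Rightarrow> real"
    and P \<eta> :: real
  assumes "\<And>k. (\<sigma> k)\<^sup>2 > 0"
    and "\<And>k. \<omega> k > 0"
    and "P > 0"
    and "w0 \<in> feasible P"
    and "\<eta> > 0"
    and "\<eta> \<ge> lambda_max (mat_S h \<sigma> \<omega> w0)"
  shows "(\<forall>w\<in>feasible P. surrogate h \<sigma> \<omega> \<eta> w w0 \<le> weighted_sum_rate h \<sigma> \<omega> w)
    \<and> surrogate h \<sigma> \<omega> \<eta> w0 w0 = weighted_sum_rate h \<sigma> \<omega> w0
    \<and> (\<forall>w. is_arg_max (\<lambda>w. surrogate h \<sigma> \<omega> \<eta> w w0) (\<lambda>w. w \<in> feasible P) w
          \<longleftrightarrow> is_arg_min (\<lambda>w. \<Sum>k\<in>UNIV. \<eta> * (norm (w k - vec_q h \<sigma> \<omega> \<eta> w0 k))\<^sup>2)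
                (\<lambda>w. w \<in> feasible P) w)
    \<and> (\<forall>w. is_arg_max (\<lambda>w. surrogate h \<sigma> \<omega> \<eta> w w0) (\<lambda>w. w \<in> feasible P) w
          \<longleftrightarrow> w = scaled_to_budget P (vec_q h \<sigma> \<omega> \<eta> w0))"
proof -
  let ?f = "\<lambda>w. surrogate h \<sigma> \<omega> \<eta> w w0"
  let ?F = "\<lambda>w. \<Sum>k\<in>UNIV. \<eta> * (norm (w k - vec_q h \<sigma> \<omega> \<eta> w0 k))\<^sup>2"
  obtain C where C: "\<And>w. ?f w = C - ?F w"
    using surrogate_complete_square[OF \<open>\<eta> > 0\<close>, of h \<sigma> \<omega> w0] by blast
  \<comment> \<open>The constant \<open>C\<close> cancels in every comparison of two values, and the
    sign flips the order.\<close>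
  have equiv: "is_arg_max ?f (\<lambda>w. w \<in> feasible P) w \<longleftrightarrow> is_arg_min ?F (\<lambda>w. w \<in> feasible P) w" for w
    by (simp add: is_arg_max_def is_arg_min_def C)
  have "?f w \<le> weighted_sum_rate h \<sigma> \<omega> w" for w
  proof -
    \<comment> \<open>Makes every summand of the loss in
      \<open>surrogate_eq_sum_rate_minorant\<close> nonnegative.\<close>
    have "x \<bullet> (mat_S h \<sigma> \<omega> w0 *v x) \<le> \<eta> * (x \<bullet> x)" for x
      using inner_mult_vec_le_lambda_max[OF mat_S_selfadjoint, of x] assms(6)
      by (meson inner_ge_zero mult_right_mono order_trans)
    then have "?f w \<le> (\<Sum>k\<in>UNIV. \<omega> k * rate_minorant h \<sigma> w w0 k)"
      unfolding surrogate_eq_sum_rate_minorant by (simp add: sum_nonneg)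
    also have "\<dots> \<le> weighted_sum_rate h \<sigma> \<omega> w"
      unfolding weighted_sum_rate_def using assms(1,2)
      by (intro sum_mono mult_left_mono rate_minorant_le) (auto intro: less_imp_le)
    finally show ?thesis .
  qed
  then have lower: "\<forall>w\<in>feasible P. ?f w \<le> weighted_sum_rate h \<sigma> \<omega> w" by simp
  have tight: "?f w0 = weighted_sum_rate h \<sigma> \<omega> w0"
    by (simp add: surrogate_eq_sum_rate_minorant weighted_sum_rate_def
        rate_minorant_self[of \<sigma>, OF assms(1)])
  show ?thesis
    unfolding equiv is_arg_min_scaled_to_budget_iff[OF \<open>P > 0\<close> \<open>\<eta> > 0\<close>]
    using lower tight by simp
qed

end
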